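(* Let $n\ge2$, let $\Omega$ be an open set in $\mathbb{R}^n$ of class $C^1$, let $x_0\in\partial\Omega$ and let $U$ be an open neighbourhood of $x_0$. Let $G\in C^1(\overline{\Omega\cap U})$ be a non-negative function such that $G(x)=0$ and $\nabla G(x)\ne0$ for all $x\in U\cap\partial\Omega$. Then $$\lim_{x\to x_0}\frac{|\nabla G(x)|}{G(x)}\,\delta(x)=1,$$ where the limit is taken over $x\in\Omega\cap U$. Moreover, if $\omega$ is a modulus of continuity of $\nabla G$ in a neighbourhood of $x_0$, then $$\left|\frac{\nabla G(x)}{G(x)}\right|=\frac1{\delta(x)}+\frac{O(\omega(\delta(x)))}{\delta(x)}\qquad\text{as }x\to x_0,\ x\in\Omega\cap U.$$
   Context: $\delta(x)=d(x,\partial\Omega)$ is the distance to the boundary. $\Omega$ is of class $C^1$ if locally around each boundary point it is, up to an isometry, the subgraph of a $C^1$ function. $G\in C^1(\overline{\Omega\cap U})$ means that $G$ is $C^1$ in $\Omega\cap U$ and $G$, $\nabla G$ extend continuously to the closure. A modulus of continuity of a real- or vector-valued function $f$ on $A\subset\mathbb{R}^n$ is an increasing function $\omega:[0,\infty)\to[0,\infty)$ with $\omega(t)\to0$ as $t\to0$ and $|f(x)-f(y)|\le\omega(|x-y|)$ for all $x,y\in A$; here $A=\overline{\Omega\cap U}\cap B$ for some neighbourhood $B$ of $x_0$. *)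

theory Defs
  imports "HOL-Analysis.Analysis" "HOL-Library.Landau_Symbols"
begin

definition C1_on :: "'a::real_inner set \<Rightarrow> ('a \<Rightarrow> real) \<Rightarrow> ('a \<Rightarrow> 'a) \<Rightarrow> bool" where
  "C1_on S f Df \<longleftrightarrow> (\<forall>x\<in>S. GDERIV f x :> Df x) \<and> continuous_on S Df"

text \<open>\<open>f \<in> C\<^sup>1(closure S)\<close> for an open set \<open>S\<close>. The values of \<open>f\<close> and \<open>Df\<close> on the frontier of \<open>S\<close>
  are those of the continuous extensions, so they are determined by \<open>f\<close> on \<open>S\<close>. The functions
  are not required to be differentiable, nor even continuous, at frontier points as functions
  on the whole space.\<close>

definition C1_closure :: "'a::real_inner set \<Rightarrow> ('a \<Rightarrow> real) \<Rightarrow> ('a \<Rightarrow> 'a) \<Rightarrow> bool" where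
  "C1_closure S f Df \<longleftrightarrow>
     C1_on S f Df \<and> continuous_on (closure S) f \<and> continuous_on (closure S) Df"

text \<open>A \<open>C\<^sup>1\<close> function of \<open>n - 1\<close> variables is encoded as a \<open>C\<^sup>1\<close> function \<open>\<phi>\<close> on \<open>\<real>\<^sup>n\<close> that does not
  depend on the \<open>k\<close>-th coordinate; \<open>{y. y $ k < \<phi> y}\<close> is then its subgraph. The isometry \<open>T\<close>
  makes the choice of \<open>k\<close> immaterial.\<close>

definition C1_domain :: "(real ^ 'n) set \<Rightarrow> bool" where
  "C1_domain \<Omega> \<longleftrightarrow>
     (\<forall>p\<in>frontier \<Omega>. \<exists>V (T :: real ^ 'n \<Rightarrow> real ^ 'n) k \<phi> D\<phi>.
        open V \<and> p \<in> V \<and>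
        (\<forall>x y. dist (T x) (T y) = dist x y) \<and>
        C1_on UNIV \<phi> D\<phi> \<and>
        (\<forall>y s. \<phi> (y + s *\<^sub>R axis k 1) = \<phi> y) \<and>
        \<Omega> \<inter> V = {x \<in> V. T x $ k < \<phi> (T x)})"

text \<open>Only the values of \<open>\<omega>\<close> on \<open>[0, \<infinity>)\<close> matter.\<close>

definition modulus_of_continuity ::
  "(real \<Rightarrow> real) \<Rightarrow> ('a::metric_space \<Rightarrow> 'b::metric_space) \<Rightarrow> 'a set \<Rightarrow> bool" where
  "modulus_of_continuity \<omega> f A \<longleftrightarrow>
     mono_on {0..} \<omega> \<and> (\<forall>t\<ge>0. 0 \<le> \<omega> t) \<and> (\<omega> \<longlongrightarrow> 0) (at_right 0) \<and>
     (\<forall>x\<in>A. \<forall>y\<in>A. dist (f x) (f y) \<le> \<omega> (dist x y))"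

end

theory Submission
  imports Defs
begin

text \<open>Let \<open>x \<in> \<Omega>\<close> be near \<open>x0\<close>, \<open>\<delta> = d(x, \<partial>\<Omega>)\<close>, and let \<open>e\<close> bound the oscillation of \<open>\<nabla>G\<close> on the ball
  \<open>B(x, \<delta>) \<subseteq> \<Omega>\<close>. The mean value theorem on the segment from \<open>x\<close> to a nearest boundary point, where
  \<open>G\<close> vanishes, gives \<open>G x \<le> (\<bar>\<nabla>G x\<bar> + e) \<delta>\<close>. Going from \<open>x\<close> in the direction \<open>-\<nabla>G x\<close> inside the ball,
  where \<open>G \<ge> 0\<close>, gives \<open>G x \<ge> (\<bar>\<nabla>G x\<bar> - e) \<delta>\<close>. Continuity of \<open>\<nabla>G\<close> makes \<open>e\<close> small, and a modulus of
  continuity allows \<open>e = \<omega> \<delta>\<close>. Since \<open>\<nabla>G x0 \<noteq> 0\<close>, dividing by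
  \<open>G x \<ge> c \<delta>\<close> with \<open>c > 0\<close> yields both claims.\<close>

text \<open>The mean value theorem on the segment from \<open>x\<close> to \<open>q\<close>. The
  endpoint \<open>q\<close> may lie on the sphere, where only continuity of \<open>G\<close> is
  asked, because the intermediate point given by the theorem is in the open ball.\<close>

lemma gderiv_linear_approx:
  fixes G :: "'a::real_inner \<Rightarrow> real"
  assumes der: "\<And>y. y \<in> ball x d \<Longrightarrow> GDERIV G y :> DG y"
    and osc: "\<And>y. y \<in> ball x d \<Longrightarrow> norm (DG y - DG x) \<le> e"
    and cont: "continuous_on (insert q (ball x d)) G"
    and "dist x q \<le> d"
  shows "\<bar>G q - G x - inner (DG x) (q - x)\<bar> \<le> e * norm (q - x)"
proof (cases "q = x")
  case False
  let ?p = "\<lambda>t. x + t *\<^sub>R (q - x)"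
  have inball: "?p t \<in> ball x d" if "0 \<le> t" "t < 1" for t
  proof -
    have "t * norm (q - x) < norm (q - x)" using that False by simp
    then show ?thesis using that \<open>dist x q \<le> d\<close> by (simp add: dist_norm norm_minus_commute)
  qed
  have "?p ` {0..1} \<subseteq> insert q (ball x d)"
  proof
    fix z assume "z \<in> ?p ` {0..1}"
    then obtain t where t: "0 \<le> t" "t \<le> 1" "z = ?p t" by auto
    show "z \<in> insert q (ball x d)"
      using inball[of t] t by (cases "t = 1") auto
  qed
  then have "continuous_on {0..1} (\<lambda>t. G (?p t))"
    by (intro continuous_on_compose2[OF cont] continuous_intros)
  moreover have "((\<lambda>t. G (?p t)) has_derivative (\<lambda>h. h * inner (DG (?p t)) (q - x))) (at t)"
    if "0 < t" "t < 1" for t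
  proof -
    have "(G has_derivative (\<lambda>h. inner h (DG (?p t)))) (at (?p t))"
      using der[OF inball] that by (simp add: gderiv_def)
    moreover have "(?p has_derivative (\<lambda>h. h *\<^sub>R (q - x))) (at t)"
      by (auto intro!: derivative_eq_intros)
    ultimately show ?thesis
      by (auto dest: has_derivative_compose simp: inner_commute)
  qed
  ultimately obtain t where t: "0 < t" "t < 1" "G q - G x = inner (DG (?p t)) (q - x)"
    using mvt[of 0 1 "\<lambda>t. G (?p t)" "\<lambda>t h. h * inner (DG (?p t)) (q - x)"] by auto
  have "\<bar>G q - G x - inner (DG x) (q - x)\<bar> = \<bar>inner (DG (?p t) - DG x) (q - x)\<bar>"
    by (simp add: t(3) inner_diff_left)
  also have "\<dots> \<le> norm (DG (?p t) - DG x) * norm (q - x)"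
    by (rule Cauchy_Schwarz_ineq2)
  also have "\<dots> \<le> e * norm (q - x)"
    using osc[OF inball] t by (intro mult_right_mono) auto
  finally show ?thesis .
qed simp

text \<open>Both one-sided bounds on a ball that touches the zero set of \<open>G\<close> at
  \<open>p\<close>: the zero at \<open>p\<close> bounds \<open>G x\<close> from above, nonnegativity
  along the direction of steepest descent bounds it from below.\<close>

lemma norm_gradient_times_radius_approx:
  fixes G :: "'a::real_inner \<Rightarrow> real"
  assumes "0 < d"
    and der: "\<And>y. y \<in> ball x d \<Longrightarrow> GDERIV G y :> DG y"
    and osc: "\<And>y. y \<in> ball x d \<Longrightarrow> norm (DG y - DG x) \<le> e"
    and nonneg: "\<And>y. y \<in> ball x d \<Longrightarrow> 0 \<le> G y"
    and cont: "continuous_on (insert p (ball x d)) G"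
    and p: "dist x p = d" "G p = 0"
  shows "\<bar>norm (DG x) * d - G x\<bar> \<le> e * d"
proof -
  let ?n = "norm (DG x)"
  have np: "norm (p - x) = d" using p by (simp add: dist_norm norm_minus_commute)
  have "\<bar>G p - G x - inner (DG x) (p - x)\<bar> \<le> e * d"
    using gderiv_linear_approx[OF der osc cont] p unfolding np by simp
  moreover have "\<bar>inner (DG x) (p - x)\<bar> \<le> ?n * d"
    using Cauchy_Schwarz_ineq2[of "DG x" "p - x"] np by simp
  ultimately have upper: "G x \<le> ?n * d + e * d" using p(2) by linarith
  have "(?n - e) * d \<le> G x"
  proof (cases "?n \<le> e")
    case True
    then have "(?n - e) * d \<le> 0" using \<open>0 < d\<close> by (simp add: mult_nonpos_nonneg)
    then show ?thesis using nonneg[of x] \<open>0 < d\<close> by auto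
  next
    case False
    have "0 \<le> e" using osc[of x] \<open>0 < d\<close> by simp
    then have n: "DG x \<noteq> 0" using False by auto
    \<comment> \<open>A step of length exactly \<open>d\<close> would leave the open ball, so the
      bound is proved for every \<open>s < d\<close>. With \<open>s\<close> isolated on the left,
      letting \<open>s\<close> tend to \<open>d\<close> is \<open>dense_le_bounded\<close>.\<close>
    have "s \<le> G x / (?n - e)" if s: "0 < s" "s < d" for s
    proof -
      define q where "q = x - s *\<^sub>R sgn (DG x)"
      have nq: "norm (q - x) = s" using n s by (simp add: q_def norm_sgn)
      then have qb: "q \<in> ball x d" using s by (simp add: dist_norm norm_minus_commute)
      have "inner (DG x) (q - x) = - s * ?n"
        using n by (simp add: q_def sgn_div_norm power2_norm_eq_inner[symmetric] power2_eq_square)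
      moreover have "\<bar>G q - G x - inner (DG x) (q - x)\<bar> \<le> e * norm (q - x)"
        using qb by (intro gderiv_linear_approx[OF der osc]) (auto intro: continuous_on_subset[OF cont])
      ultimately have "s * (?n - e) \<le> G x"
        using nonneg[OF qb] nq by (simp add: algebra_simps)
      then show ?thesis using False by (simp add: pos_le_divide_eq)
    qed
    then have "d \<le> G x / (?n - e)"
      using \<open>0 < d\<close> by (intro dense_le_bounded[of 0 d]) auto
    then show ?thesis using False by (simp add: pos_le_divide_eq mult.commute)
  qed
  with upper show ?thesis by (simp add: algebra_simps abs_le_iff)
qed

text \<open>A connected set that meets \<Omega> but not its frontier stays inside \<Omega>. If the
  frontier is empty, \<open>infdist\<close> is 0 by convention and the ball is empty.\<close>

lemma ball_infdist_frontier_subset: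
  fixes \<Omega> :: "'a::euclidean_space set"
  assumes "open \<Omega>" "x \<in> \<Omega>"
  shows "ball x (infdist x (frontier \<Omega>)) \<subseteq> \<Omega>"
proof (cases "infdist x (frontier \<Omega>) > 0")
  case True
  let ?d = "infdist x (frontier \<Omega>)"
  have "ball x ?d \<inter> frontier \<Omega> = {}"
    using infdist_le[of _ "frontier \<Omega>" x] by force
  moreover have "connected (ball x ?d)" by simp
  moreover have "x \<in> ball x ?d \<inter> \<Omega>" using assms True by simp
  ultimately show ?thesis
    using connected_Int_frontier[of "ball x ?d" \<Omega>] by blast
next
  case False
  then show ?thesis by (metis ball_eq_empty empty_subsetI not_less)
qed

text \<open>The ball estimate with the distance to the frontier as radius and a nearest frontier
  point as contact point. The oscillation is bounded only within that distance of \<open>x\<close>,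
  so \<open>e\<close> may be a fixed constant or may depend on the distance.\<close>

lemma gradient_infdist_frontier_approx:
  fixes \<Omega> U :: "'a::euclidean_space set"
  assumes "open \<Omega>"
    and C1: "C1_closure (\<Omega> \<inter> U) G DG"
    and nonneg: "\<And>x. x \<in> closure (\<Omega> \<inter> U) \<Longrightarrow> 0 \<le> G x"
    and zero: "\<And>x. x \<in> U \<inter> frontier \<Omega> \<Longrightarrow> G x = 0"
    and z: "z \<in> frontier \<Omega>" and near: "ball z (2 * r) \<subseteq> U"
    and x: "x \<in> \<Omega>" "dist x z < r"
    and osc: "\<And>y. \<lbrakk>y \<in> \<Omega> \<inter> ball z (2 * r); dist y x < infdist x (frontier \<Omega>)\<rbrakk> \<Longrightarrow>
      dist (DG y) (DG x) \<le> e"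
  shows "\<bar>norm (DG x) * infdist x (frontier \<Omega>) - G x\<bar> \<le> e * infdist x (frontier \<Omega>)"
proof -
  define d where "d = infdist x (frontier \<Omega>)"
  have "frontier \<Omega> \<noteq> {}" using z by auto
  then obtain p where p: "p \<in> frontier \<Omega>" "dist x p = d"
    using infdist_attains_inf[of "frontier \<Omega>" x] unfolding d_def by (metis frontier_closed)
  have "p \<notin> \<Omega>" using p(1) \<open>open \<Omega>\<close> by (simp add: frontier_def interior_open)
  then have "0 < d" using p x by auto
  have "d < r" using infdist_le[OF z, of x] x(2) d_def by simp
  \<comment> \<open>Since \<open>z\<close> itself is a frontier point,
    \<open>d \<le> dist x z < r\<close>. Doubling the radius therefore keeps the nearest point
    \<open>p\<close> in \<open>U\<close>, where \<open>G\<close> is known to vanish.\<close>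
  have cb: "cball x d \<subseteq> ball z (2 * r)"
  proof
    fix y assume "y \<in> cball x d"
    then show "y \<in> ball z (2 * r)"
      using dist_triangle[of z y x] \<open>d < r\<close> x(2) by (simp add: dist_commute)
  qed
  have sub: "ball x d \<subseteq> \<Omega> \<inter> U"
    using ball_infdist_frontier_subset[OF \<open>open \<Omega>\<close> x(1)] cb near d_def by fastforce
  \<comment> \<open>The point \<open>p\<close> is a limit of points of the ball, hence of \<Omega>
    \<inter> \<open>U\<close>, so the continuous extension of \<open>G\<close> covers it.\<close>
  have "p \<in> closure (ball x d)" using p \<open>0 < d\<close> by simp
  then have "insert p (ball x d) \<subseteq> closure (\<Omega> \<inter> U)"
    using sub closure_mono[OF sub] closure_subset[of "\<Omega> \<inter> U"] by blast
  then have "continuous_on (insert p (ball x d)) G"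
    using C1 continuous_on_subset unfolding C1_closure_def by blast
  moreover have "p \<in> U" using cb near p(2) by auto
  ultimately have "\<bar>norm (DG x) * d - G x\<bar> \<le> e * d"
  proof (intro norm_gradient_times_radius_approx[OF \<open>0 < d\<close>, where p = p])
    fix y assume y: "y \<in> ball x d"
    show "GDERIV G y :> DG y" using C1 sub y unfolding C1_closure_def C1_on_def by blast
    show "0 \<le> G y" using nonneg sub y closure_subset by blast
    have "y \<in> ball z (2 * r)" using cb y ball_subset_cball by blast
    then show "norm (DG y - DG x) \<le> e"
      using osc[of y] sub y d_def by (auto simp: dist_norm norm_minus_commute)
  qed (use p zero in auto)
  then show ?thesis by (simp add: d_def)
qed

theorem lemma3p2:
  fixes \<Omega> U :: "(real ^ 'n) set" and x0 :: "real ^ 'n"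
    and G :: "real ^ 'n \<Rightarrow> real" and DG :: "real ^ 'n \<Rightarrow> real ^ 'n"
  assumes "CARD('n) \<ge> 2"
    and "open \<Omega>" and "C1_domain \<Omega>"
    and "x0 \<in> frontier \<Omega>"
    and "open U" and "x0 \<in> U"
    and "C1_closure (\<Omega> \<inter> U) G DG"
    and "\<And>x. x \<in> closure (\<Omega> \<inter> U) \<Longrightarrow> G x \<ge> 0"
    and "\<And>x. x \<in> U \<inter> frontier \<Omega> \<Longrightarrow> G x = 0 \<and> DG x \<noteq> 0"
  shows "((\<lambda>x. norm (DG x) / G x * infdist x (frontier \<Omega>)) \<longlongrightarrow> 1) (at x0 within \<Omega> \<inter> U) \<and>
    (\<forall>\<omega> B. x0 \<in> interior B \<and> modulus_of_continuity \<omega> DG (closure (\<Omega> \<inter> U) \<inter> B) \<longrightarrow>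
      (\<exists>E \<in> O[at x0 within \<Omega> \<inter> U](\<lambda>x. \<omega> (infdist x (frontier \<Omega>))).
         \<forall>\<^sub>F x in at x0 within \<Omega> \<inter> U.
           norm (DG x /\<^sub>R G x) = 1 / infdist x (frontier \<Omega>) + E x / infdist x (frontier \<Omega>)))"
proof (intro conjI allI impI)
  let ?F = "at x0 within \<Omega> \<inter> U"
  define \<delta> where "\<delta> x = infdist x (frontier \<Omega>)" for x
  have zero: "\<And>x. x \<in> U \<inter> frontier \<Omega> \<Longrightarrow> G x = 0" using assms(9) by blast
  have approx: "\<bar>norm (DG x) * \<delta> x - G x\<bar> \<le> e * \<delta> x"
    if "ball x0 (2 * r) \<subseteq> U" "x \<in> \<Omega>" "dist x x0 < r"
      "\<And>y. \<lbrakk>y \<in> \<Omega> \<inter> ball x0 (2 * r); dist y x < \<delta> x\<rbrakk> \<Longrightarrow> dist (DG y) (DG x) \<le> e" for r x e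
    unfolding \<delta>_def
    by (rule gradient_infdist_frontier_approx[where U = U and z = x0 and r = r])
      (use assms that zero in \<open>auto simp: \<delta>_def\<close>)
  have \<delta>_pos: "0 < \<delta> x" if "x \<in> \<Omega>" for x
  proof -
    have "x \<notin> frontier \<Omega>" using that \<open>open \<Omega>\<close> by (simp add: frontier_def interior_open)
    then show ?thesis
      using assms(4) infdist_pos_not_in_closed[of "frontier \<Omega>" x] by (auto simp: \<delta>_def)
  qed
  have x0: "x0 \<in> closure (\<Omega> \<inter> U)"
    using assms(4-6) open_Int_closure_subset[of U \<Omega>] by (auto simp: frontier_def Int_commute)
  have near: "eventually P ?F"
    if "0 < r" "\<And>x. x \<in> \<Omega> \<inter> U \<Longrightarrow> dist x x0 < r \<Longrightarrow> P x" for r P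
    using that unfolding eventually_at by blast
  \<comment> \<open>Supplies the radius in every later localisation; \<open>B = UNIV\<close> is
    taken when no neighbourhood is prescribed.\<close>
  have osc: "\<exists>r>0. ball x0 (2 * r) \<subseteq> U \<inter> interior B \<and>
      (\<forall>y\<in>closure (\<Omega> \<inter> U) \<inter> ball x0 (2 * r). dist (DG y) (DG x0) < e)"
    if "0 < e" "x0 \<in> interior B" for e B
  proof -
    have "continuous_on (closure (\<Omega> \<inter> U)) DG" using assms(7) by (simp add: C1_closure_def)
    with x0 that(1) obtain r1 where r1: "r1 > 0"
      "\<And>y. y \<in> closure (\<Omega> \<inter> U) \<Longrightarrow> dist y x0 < r1 \<Longrightarrow> dist (DG y) (DG x0) < e"
      unfolding continuous_on_iff by blast
    have "open (U \<inter> interior B)" "x0 \<in> U \<inter> interior B" using that assms(5,6) by auto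
    then obtain r2 where r2: "r2 > 0" "ball x0 r2 \<subseteq> U \<inter> interior B"
      by (rule openE)
    show ?thesis
      using r1 r2 by (intro exI[of _ "min r1 r2 / 2"]) (auto simp: dist_commute)
  qed
  have close: "\<forall>\<^sub>F x in ?F. \<bar>norm (DG x) * \<delta> x - G x\<bar> \<le> e * \<delta> x" if e: "0 < e" for e
  proof -
    \<comment> \<open>Closeness \<open>e / 2\<close> to \<open>DG x0\<close> bounds the oscillation
      between any two points by \<open>e\<close>.\<close>
    obtain r where r: "r > 0" "ball x0 (2 * r) \<subseteq> U"
      "\<forall>y\<in>closure (\<Omega> \<inter> U) \<inter> ball x0 (2 * r). dist (DG y) (DG x0) < e / 2"
      using osc[of "e / 2" UNIV] e by auto
    show ?thesis
    proof (rule near[OF r(1)])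
      fix x assume x: "x \<in> \<Omega> \<inter> U" "dist x x0 < r"
      have o: "dist (DG y) (DG x0) < e / 2" if "y \<in> \<Omega> \<inter> ball x0 (2 * r)" for y
        using r that closure_subset[of "\<Omega> \<inter> U"] by blast
      have "x \<in> \<Omega> \<inter> ball x0 (2 * r)" using x r(1) by (auto simp: dist_commute)
      then show "\<bar>norm (DG x) * \<delta> x - G x\<bar> \<le> e * \<delta> x"
        using x by (intro approx[OF r(2)] less_imp_le[OF dist_triangle_half_l[OF o o]]) auto
    qed
  qed
  \<comment> \<open>Near \<open>x0\<close> the gradient changes by less than \<open>c\<close>, so
    its norm is at least \<open>4c - c = 3c\<close>. The estimate \<open>close\<close> with error
    \<open>c\<close> then gives \<open>G x \<ge> 2c * \<delta> x\<close>, more than the bound in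
    \<open>lower\<close>.\<close>
  define c where "c = norm (DG x0) / 4"
  have "0 < c" using assms(4,6,9) by (simp add: c_def)
  have lower: "\<forall>\<^sub>F x in ?F. 0 < \<delta> x \<and> c * \<delta> x \<le> G x"
  proof -
    obtain r where r: "r > 0" "\<forall>y\<in>closure (\<Omega> \<inter> U) \<inter> ball x0 (2 * r). dist (DG y) (DG x0) < c"
      using osc[of c UNIV] \<open>0 < c\<close> by auto
    have "\<forall>\<^sub>F x in ?F. 0 < \<delta> x \<and> 3 * c \<le> norm (DG x)"
    proof (rule near[OF r(1)])
      fix x assume x: "x \<in> \<Omega> \<inter> U" "dist x x0 < r"
      then have "dist (DG x) (DG x0) < c"
        using r closure_subset[of "\<Omega> \<inter> U"] by (auto simp: dist_commute)
      then have "norm (DG x0) \<le> norm (DG x) + c"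
        using norm_triangle_ineq2[of "DG x0" "DG x"] by (simp add: dist_norm norm_minus_commute)
      then show "0 < \<delta> x \<and> 3 * c \<le> norm (DG x)" using \<delta>_pos x by (simp add: c_def)
    qed
    then show ?thesis using close[OF \<open>0 < c\<close>]
    proof eventually_elim
      case (elim x)
      then have "3 * (c * \<delta> x) \<le> norm (DG x) * \<delta> x"
        unfolding mult.assoc[symmetric] by (intro mult_right_mono) auto
      moreover have "0 < c * \<delta> x" using elim \<open>0 < c\<close> by simp
      ultimately have "c * \<delta> x \<le> G x" using elim(2) by linarith
      then show ?case using elim(1) by blast
    qed
  qed
  \<comment> \<open>The common division step: a constant \<open>e\<close> yields the limit, and
    \<open>e = \<omega> (\<delta> x)\<close> yields the rate.\<close>
  have quotient: "\<bar>norm (DG x) / G x * \<delta> x - 1\<bar> \<le> e / c"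
    if "\<bar>norm (DG x) * \<delta> x - G x\<bar> \<le> e * \<delta> x" "0 < \<delta> x \<and> c * \<delta> x \<le> G x" for x e
  proof -
    have pos: "0 < c * \<delta> x" using that \<open>0 < c\<close> by simp
    then have "0 < G x" using that by linarith
    have "\<bar>norm (DG x) / G x * \<delta> x - 1\<bar> = \<bar>norm (DG x) * \<delta> x - G x\<bar> / G x"
      using \<open>0 < G x\<close> by (simp add: divide_simps abs_if)
    also have "\<dots> \<le> \<bar>norm (DG x) * \<delta> x - G x\<bar> / (c * \<delta> x)"
      using that pos \<open>0 < G x\<close> by (intro divide_left_mono) auto
    also have "\<dots> \<le> e * \<delta> x / (c * \<delta> x)"
      using that pos by (intro divide_right_mono) auto
    also have "\<dots> = e / c" using that by simp
    finally show ?thesis .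
  qed
  show "((\<lambda>x. norm (DG x) / G x * infdist x (frontier \<Omega>)) \<longlongrightarrow> 1) ?F"
    unfolding \<delta>_def[symmetric] tendsto_iff
  proof (intro allI impI)
    fix e :: real assume "0 < e"
    \<comment> \<open>Chosen so that \<open>quotient\<close> returns \<open>e / 2\<close>, strictly
      below \<open>e\<close>.\<close>
    then have "0 < e / 2 * c" using \<open>0 < c\<close> by simp
    from close[OF this] lower
    show "\<forall>\<^sub>F x in ?F. dist (norm (DG x) / G x * \<delta> x) 1 < e"
    proof eventually_elim
      case (elim x)
      show ?case using quotient[OF elim] \<open>0 < c\<close> \<open>0 < e\<close> by (simp add: dist_real_def)
    qed
  qed
  fix \<omega> B
  assume "x0 \<in> interior B \<and> modulus_of_continuity \<omega> DG (closure (\<Omega> \<inter> U) \<inter> B)"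
  then have B: "x0 \<in> interior B" and \<omega>: "modulus_of_continuity \<omega> DG (closure (\<Omega> \<inter> U) \<inter> B)"
    by auto
  \<comment> \<open>With this relative error the claimed expansion is an algebraic identity wherever
    \<open>G x\<close> and \<open>\<delta> x\<close> are positive; the content lies in the bound on
    \<open>E\<close>.\<close>
  define E where "E = (\<lambda>x. norm (DG x) / G x * \<delta> x - 1)"
  have "\<forall>\<^sub>F x in ?F. \<bar>norm (DG x) * \<delta> x - G x\<bar> \<le> \<omega> (\<delta> x) * \<delta> x"
  proof -
    obtain r where r: "r > 0" "ball x0 (2 * r) \<subseteq> U \<inter> interior B"
      using osc[OF zero_less_one B] by auto
    show ?thesis
    proof (rule near[OF r(1)])
      fix x assume x: "x \<in> \<Omega> \<inter> U" "dist x x0 < r"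
      have mem: "y \<in> closure (\<Omega> \<inter> U) \<inter> B" if "y \<in> \<Omega> \<inter> ball x0 (2 * r)" for y
        using r that closure_subset[of "\<Omega> \<inter> U"] interior_subset[of B] by blast
      show "\<bar>norm (DG x) * \<delta> x - G x\<bar> \<le> \<omega> (\<delta> x) * \<delta> x"
      proof (rule approx)
        fix y assume y: "y \<in> \<Omega> \<inter> ball x0 (2 * r)" "dist y x < \<delta> x"
        have "x \<in> \<Omega> \<inter> ball x0 (2 * r)" using x r(1) by (auto simp: dist_commute)
        \<comment> \<open>Both points lie in the set on which \<open>\<omega>\<close> controls
          \<open>DG\<close>, and monotonicity replaces \<open>dist y x\<close> by the larger
          \<open>\<delta> x\<close>. This is what permits
          \<open>e = \<omega> (\<delta> x)\<close>.\<close>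
        then have "dist (DG y) (DG x) \<le> \<omega> (dist y x)"
          using \<omega> mem y by (auto simp: modulus_of_continuity_def)
        also have "\<dots> \<le> \<omega> (\<delta> x)"
          using \<omega> y \<delta>_pos[of x] x(1) unfolding modulus_of_continuity_def
          by (intro mono_onD[of "{0..}" \<omega>]) auto
        finally show "dist (DG y) (DG x) \<le> \<omega> (\<delta> x)" .
      qed (use r x in auto)
    qed
  qed
  \<comment> \<open>The implied constant is \<open>1 / c\<close>, which depends only on the gradient
    at \<open>x0\<close>.\<close>
  then have "\<forall>\<^sub>F x in ?F. norm (E x) \<le> 1 / c * norm (\<omega> (\<delta> x))"
    using lower
  proof eventually_elim
    case (elim x)
    have "\<omega> (\<delta> x) / c \<le> \<bar>\<omega> (\<delta> x)\<bar> / c" using \<open>0 < c\<close> by (simp add: divide_right_mono)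
    then show ?case using quotient[OF elim] by (simp add: E_def)
  qed
  then have "E \<in> O[?F](\<lambda>x. \<omega> (\<delta> x))" by (rule bigoI)
  moreover have "\<forall>\<^sub>F x in ?F. norm (DG x /\<^sub>R G x) = 1 / \<delta> x + E x / \<delta> x"
    using lower
  proof eventually_elim
    case (elim x)
    then have "0 < G x" using mult_pos_pos[OF \<open>0 < c\<close>, of "\<delta> x"] by linarith
    then show ?case using elim by (simp add: E_def field_simps)
  qed
  ultimately show "\<exists>E \<in> O[?F](\<lambda>x. \<omega> (infdist x (frontier \<Omega>))). \<forall>\<^sub>F x in ?F.
      norm (DG x /\<^sub>R G x) = 1 / infdist x (frontier \<Omega>) + E x / infdist x (frontier \<Omega>)"
    unfolding \<delta>_def[abs_def] by blast
qed

end
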